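(* Let $B=(b_{ij})\in \mathrm{M}_n(\mathbb{Z})$ be tracelike. Then $\det(B)\equiv \operatorname{dpf}(B)^2 \pmod 4$.
   Context: A symmetric matrix $B=(b_{ij})_{i,j=1}^n\in\mathrm{M}_n(\mathbb{Z})$ is called tracelike if $b_{11}=n$ and $b_{ii}\equiv b_{1i}^2 \pmod 2$ for all $i=2,\dots,n$. A perfect matching on a finite set $J$ is a partition of $J$ into subsets of cardinality $2$. The discriminant pfaffian of $B$ is $$\operatorname{dpf}(B)=\sum_{\substack{J\subseteq\{2,\dots,n\}\\ \#J \text{ even}}}\ \sum_{P \text{ perfect matching on } J}\Biggl(\prod_{\{i,j\}\in P} b_{ij}\Biggr)\Biggl(\prod_{k\in\{2,\dots,n\}\setminus J} b_{1k}\Biggr),$$ where empty products equal $1$. *)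

theory Defs
  imports
    "HOL-Library.Disjoint_Sets"
    "HOL-Number_Theory.Cong"
    "Jordan_Normal_Form.Determinant"
begin

(* Matrix indices start at 0: the entry b_{ij} with 1 <= i, j <= n is B $$ (i - 1, j - 1),
   so the distinguished first row is row 0 and {2,...,n} becomes {1..<n}. *)

definition tracelike :: "int mat \<Rightarrow> bool" where
  "tracelike B \<longleftrightarrow>
     square_mat B \<and> 0 < dim_row B \<and> transpose_mat B = B \<and>
     B $$ (0, 0) = int (dim_row B) \<and>
     (\<forall>i \<in> {1..<dim_row B}. [B $$ (i, i) = (B $$ (0, i))\<^sup>2] (mod 2))"

definition perfect_matching :: "'a set \<Rightarrow> 'a set set \<Rightarrow> bool" where
  "perfect_matching J P \<longleftrightarrow> partition_on J P \<and> (\<forall>e \<in> P. card e = 2)"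

(* The entry b_{ij} attached to an unordered pair e = {i,j}; for symmetric B the order of the
   two indices does not matter, see edge_entry_doubleton. *)
definition edge_entry :: "'a mat \<Rightarrow> nat set \<Rightarrow> 'a" where
  "edge_entry B e = B $$ (Min e, Max e)"

lemma edge_entry_doubleton:
  assumes "transpose_mat B = B" "i < dim_row B" "j < dim_row B"
  shows "edge_entry B {i, j} = B $$ (i, j)"
proof -
  have "dim_col B = dim_row B"
    using assms(1) by (metis index_transpose_mat(2))
  then have "B $$ (j, i) = B $$ (i, j)"
    using assms by (metis index_transpose_mat(1))
  then show ?thesis
    by (auto simp: edge_entry_def min_def max_def)
qed

definition dpf :: "int mat \<Rightarrow> int" where
  "dpf B =
     (\<Sum>J \<in> {J. J \<subseteq> {1..<dim_row B} \<and> even (card J)}.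
        \<Sum>P \<in> {P. perfect_matching J P}.
          (\<Prod>e \<in> P. edge_entry B e) * (\<Prod>k \<in> {1..<dim_row B} - J. B $$ (0, k)))"

end

theory Submission
  imports Defs
begin

text \<open>
  Write \<open>v\<close> for the first row of \<open>B\<close> without \<open>n\<close> and \<open>C\<close> for the lower right block, and let the hafnian be
  the sum over perfect matchings, i.e. the pfaffian modulo 2. Since \<open>B\<close> is tracelike, \<open>C + v v\<^sup>T\<close> has
  even diagonal. The number of perfect matchings of a set of even size is odd, so modulo 2
  \<open>dpf B\<close> is the hafnian of \<open>C + v v\<^sup>T\<close> (\<open>n\<close> odd), or of that matrix bordered by \<open>v\<close> (\<open>n\<close> even).
  Put \<open>\<epsilon> = (-1)^m\<close> with \<open>m = n div 2\<close>; row operations with the first row show that modulo 4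
  \<open>det B\<close> is \<open>\<epsilon>\<close> times the determinant of a symmetric matrix of size \<open>2 m\<close> with even diagonal that
  agrees with this one modulo 2 off the diagonal. The determinant of such a matrix is \<open>\<epsilon>\<close> times the square of
  its hafnian modulo 4: an odd off-diagonal entry gives a 2-by-2 pivot block of determinant \<open>-1\<close>
  modulo 4, and passing to the Schur complement preserves the hafnian modulo 2.
\<close>

section \<open>Sums over perfect matchings\<close>

text \<open>Weights are functions on sets, so symmetry is built in and no diagonal entry is ever
  evaluated. The signs of the pfaffian are dropped, which is harmless modulo 2.\<close>

definition haf :: "('a set \<Rightarrow> 'b::comm_semiring_1) \<Rightarrow> 'a set \<Rightarrow> 'b" where
  "haf w J = (\<Sum>P | perfect_matching J P. \<Prod>e\<in>P. w e)"

lemma perfect_matching_insert: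
  assumes "perfect_matching K Q" "a \<notin> K" "b \<notin> K" "a \<noteq> b"
  shows "perfect_matching (insert a (insert b K)) (insert {a, b} Q)"
proof -
  have "partition_on K Q" "\<forall>e\<in>Q. card e = 2"
    using assms(1) by (auto simp: perfect_matching_def)
  moreover have "insert a (insert b K) - {a, b} = K"
    using assms by auto
  ultimately show ?thesis
    using assms(2-4) unfolding perfect_matching_def partition_on_def disjoint_def
    by (auto simp: card_2_iff)
qed

lemma perfect_matching_remove:
  assumes "perfect_matching J P" "e \<in> P"
  shows "perfect_matching (J - e) (P - {e})"
proof -
  have P: "\<Union>P = J" "{} \<notin> P" "\<And>a b. a \<in> P \<Longrightarrow> b \<in> P \<Longrightarrow> a \<noteq> b \<Longrightarrow> a \<inter> b = {}" "\<forall>e\<in>P. card e = 2"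
    using assms(1) by (auto simp: perfect_matching_def partition_on_def disjoint_def)
  have "\<Union>(P - {e}) = J - e"
    using P(1) P(3)[of e] assms(2) by blast
  then show ?thesis
    using P by (auto simp: perfect_matching_def partition_on_def disjoint_def)
qed

lemma perfect_matching_empty: "perfect_matching {} P \<longleftrightarrow> P = {}"
  by (auto simp: perfect_matching_def partition_on_def)

lemma finite_perfect_matchings: "finite J \<Longrightarrow> finite {P. perfect_matching J P}"
  by (rule finite_subset[of _ "Pow (Pow J)"])
     (auto simp: perfect_matching_def partition_on_def)

lemma haf_empty [simp]: "haf w {} = 1"
  by (simp add: haf_def perfect_matching_empty)

text \<open>Each perfect matching of \<open>J\<close> has exactly one block \<open>{i, k}\<close>
  through \<open>i\<close>, and deleting it leaves a perfect matching of the other points. This is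
  the sign-free row expansion of a pfaffian.\<close>

lemma haf_expand:
  assumes J: "finite J" and i: "i \<in> J"
  shows "haf w J = (\<Sum>k\<in>J - {i}. w {i, k} * haf w (J - {i, k}))"
proof -
  define D where "D = (SIGMA k:J - {i}. {Q. perfect_matching (J - {i, k}) Q})"
  define h where "h = (\<lambda>(k, Q). insert {i, k} Q)"
  \<comment> \<open>No block of \<open>Q\<close> contains \<open>i\<close>, so \<open>{i, k}\<close>
    is the only block of \<open>h (k, Q)\<close> through \<open>i\<close>. It determines
    \<open>k\<close>, and then \<open>Q\<close>.\<close>
  have avoid: "e \<subseteq> J - {i, k}" if "(k, Q) \<in> D" "e \<in> Q" for k Q e
    using that unfolding D_def perfect_matching_def partition_on_def by auto
  have notin: "{i, k} \<notin> Q" if "(k, Q) \<in> D" for k Q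
    using avoid[OF that] by auto
  have inj: "inj_on h D"
  proof (rule inj_onI, clarify)
    fix k Q k' Q' assume 1: "(k, Q) \<in> D" "(k', Q') \<in> D" "h (k, Q) = h (k', Q')"
    have e: "insert {i, k} Q = insert {i, k'} Q'"
      using 1(3) by (simp add: h_def)
    have "{i, k} \<in> insert {i, k'} Q'"
      using e by auto
    moreover have "{i, k} \<notin> Q'"
      using avoid[OF 1(2)] by auto
    ultimately have "{i, k} = {i, k'}"
      by auto
    moreover have "k \<noteq> i" "k' \<noteq> i"
      using 1 by (auto simp: D_def)
    ultimately have k: "k = k'"
      by (auto simp: doubleton_eq_iff)
    then show "k = k' \<and> Q = Q'"
      using e notin[OF 1(1)] notin[OF 1(2)] by (metis insert_ident)
  qed
  have img: "h ` D = {P. perfect_matching J P}"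
  proof (intro equalityI subsetI)
    fix P assume "P \<in> h ` D"
    then obtain k Q where kQ: "(k, Q) \<in> D" "P = insert {i, k} Q"
      by (auto simp: h_def)
    then have "perfect_matching (insert i (insert k (J - {i, k}))) P"
      by (auto simp: D_def intro!: perfect_matching_insert)
    moreover have "insert i (insert k (J - {i, k})) = J"
      using kQ i by (auto simp: D_def)
    ultimately show "P \<in> {P. perfect_matching J P}"
      by simp
  next
    fix P assume "P \<in> {P. perfect_matching J P}"
    then have P: "perfect_matching J P" by simp
    then obtain e where e: "e \<in> P" "i \<in> e"
      using i by (auto simp: perfect_matching_def partition_on_def)
    have "card e = 2" "e \<subseteq> J"
      using P e by (auto simp: perfect_matching_def partition_on_def)
    then obtain k where k: "e = {i, k}" "k \<noteq> i" "k \<in> J"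
      using e by (auto simp: card_2_iff)
    have "(k, P - {e}) \<in> D"
      using perfect_matching_remove[OF P e(1)] k by (auto simp: D_def)
    moreover have "h (k, P - {e}) = P"
      using e k by (auto simp: h_def)
    ultimately show "P \<in> h ` D"
      by (metis imageI)
  qed
  have "haf w J = (\<Sum>P\<in>h ` D. \<Prod>e\<in>P. w e)"
    by (simp add: haf_def img)
  also have "\<dots> = (\<Sum>x\<in>D. \<Prod>e\<in>h x. w e)"
    by (simp add: sum.reindex[OF inj])
  also have "\<dots> = (\<Sum>(k, Q)\<in>D. w {i, k} * (\<Prod>e\<in>Q. w e))"
  proof (rule sum.cong[OF refl], clarify)
    fix k Q assume kQ: "(k, Q) \<in> D"
    have "finite Q"
      using avoid[OF kQ] J by (intro finite_subset[of Q "Pow J"]) auto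
    then show "(\<Prod>e\<in>h (k, Q). w e) = w {i, k} * (\<Prod>e\<in>Q. w e)"
      using notin[OF kQ] by (simp add: h_def)
  qed
  also have "\<dots> = (\<Sum>k\<in>J - {i}. \<Sum>Q | perfect_matching (J - {i, k}) Q. w {i, k} * (\<Prod>e\<in>Q. w e))"
    unfolding D_def using J by (intro sum.Sigma[symmetric]) (auto intro: finite_perfect_matchings)
  finally show ?thesis
    by (simp add: haf_def sum_distrib_left)
qed

lemma haf_insert:
  assumes "finite J" "i \<notin> J"
  shows "haf w (insert i J) = (\<Sum>k\<in>J. w {i, k} * haf w (J - {k}))"
proof -
  have "haf w (insert i J) = (\<Sum>k\<in>insert i J - {i}. w {i, k} * haf w (insert i J - {i, k}))"
    using assms by (intro haf_expand) auto
  moreover have "insert i J - {i} = J" "\<And>k. insert i J - {i, k} = J - {k}"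
    using assms by auto
  ultimately show ?thesis by simp
qed

text \<open>A partition into pairs forces even size. This lets the parity condition on
  \<open>J\<close> be dropped from \<open>dpf\<close>.\<close>

lemma haf_odd:
  assumes "odd (card J)"
  shows "haf w J = 0"
proof -
  have "even (card J)" if P: "perfect_matching J P" for P
  proof -
    have "card J = (\<Sum>e\<in>P. card e)"
    proof -
      \<comment> \<open>\<open>card\<close> is 0 on infinite sets, so an odd value already gives
        finiteness.\<close>
      have "finite J" using assms by (metis card.infinite even_zero)
      then have "finite P" "\<And>e. e \<in> P \<Longrightarrow> finite e"
        using P by (auto simp: perfect_matching_def card_2_iff intro: finite_elements)
      then show ?thesis
        using P by (auto simp: perfect_matching_def partition_on_def card_Union_disjoint disjoint_def
          pairwise_def disjnt_def)
    qed
    also have "\<dots> = (\<Sum>e\<in>P. 2)"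
      using P by (intro sum.cong) (auto simp: perfect_matching_def)
    finally show ?thesis by simp
  qed
  then have "{P. perfect_matching J P} = {}"
    using assms by auto
  then show ?thesis by (simp add: haf_def)
qed

lemma haf_cong:
  fixes w w' :: "'a set \<Rightarrow> int"
  assumes "\<And>i k. i \<in> J \<Longrightarrow> k \<in> J \<Longrightarrow> i \<noteq> k \<Longrightarrow> [w {i, k} = w' {i, k}] (mod m)"
  shows "[haf w J = haf w' J] (mod m)"
  unfolding haf_def
proof (intro cong_sum cong_prod)
  fix P e assume "P \<in> {P. perfect_matching J P}" "e \<in> P"
  then have "card e = 2" "e \<subseteq> J"
    by (auto simp: perfect_matching_def partition_on_def)
  then show "[w e = w' e] (mod m)"
    using assms by (auto simp: card_2_iff)
qed

text \<open>Relabelling invariance. Comparing the expansions along \<open>i\<close> and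
  \<open>f i\<close> avoids transporting whole partitions along \<open>f\<close>.\<close>

lemma haf_image:
  assumes "finite J" "inj_on f J"
  shows "haf w (f ` J) = haf (\<lambda>e. w (f ` e)) J"
  using assms
proof (induction "card J" arbitrary: J rule: less_induct)
  case less
  show ?case
  proof (cases "J = {}")
    case False
    then obtain i where i: "i \<in> J" by auto
    have "haf w (f ` J) = (\<Sum>k\<in>f ` J - {f i}. w {f i, k} * haf w (f ` J - {f i, k}))"
      using i less.prems by (intro haf_expand) auto
    also have "f ` J - {f i} = f ` (J - {i})"
      using inj_on_image_set_diff[OF less.prems(2), of J "{i}"] i by auto
    also have "(\<Sum>k\<in>f ` (J - {i}). w {f i, k} * haf w (f ` J - {f i, k}))
      = (\<Sum>k\<in>J - {i}. w {f i, f k} * haf w (f ` J - {f i, f k}))"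
      using less.prems(2) by (subst sum.reindex) (auto intro: inj_on_subset)
    also have "\<dots> = (\<Sum>k\<in>J - {i}. w (f ` {i, k}) * haf (\<lambda>e. w (f ` e)) (J - {i, k}))"
    proof (intro sum.cong refl)
      fix k assume k: "k \<in> J - {i}"
      have "f ` J - {f i, f k} = f ` (J - {i, k})"
        using inj_on_image_set_diff[OF less.prems(2), of J "{i, k}"] i k by auto
      moreover have "haf w (f ` (J - {i, k})) = haf (\<lambda>e. w (f ` e)) (J - {i, k})"
        using less.prems i k
        by (intro less.hyps) (auto intro: inj_on_subset intro!: psubset_card_mono)
      ultimately show "w {f i, f k} * haf w (f ` J - {f i, f k})
        = w (f ` {i, k}) * haf (\<lambda>e. w (f ` e)) (J - {i, k})" by simp
    qed
    also have "\<dots> = haf (\<lambda>e. w (f ` e)) J"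
      by (subst haf_expand[OF less.prems(1) i]) simp
    finally show ?thesis .
  qed auto
qed

section \<open>Parity of double sums and the pivot rule for hafnians\<close>

lemma even_sum_offdiag_symmetric:
  fixes g :: "'a \<Rightarrow> 'a \<Rightarrow> int"
  assumes "finite L" "\<And>k l. k \<in> L \<Longrightarrow> l \<in> L \<Longrightarrow> g k l = g l k"
  shows "even (\<Sum>k\<in>L. \<Sum>l\<in>L - {k}. g k l)"
  using assms
proof (induction L rule: finite_induct)
  case (insert a L)
  \<comment> \<open>The row and the column of the new element \<open>a\<close> agree by symmetry, so
    together they contribute an even number.\<close>
  have "(\<Sum>k\<in>L. \<Sum>l\<in>insert a L - {k}. g k l) = (\<Sum>k\<in>L. g k a + (\<Sum>l\<in>L - {k}. g k l))"
  proof (intro sum.cong refl)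
    fix k assume "k \<in> L"
    then have "insert a L - {k} = insert a (L - {k})"
      using insert by auto
    then show "(\<Sum>l\<in>insert a L - {k}. g k l) = g k a + (\<Sum>l\<in>L - {k}. g k l)"
      using insert by simp
  qed
  also have "\<dots> = (\<Sum>l\<in>L. g a l) + (\<Sum>k\<in>L. \<Sum>l\<in>L - {k}. g k l)"
    using insert.prems by (simp add: sum.distrib)
  finally have "(\<Sum>k\<in>insert a L. \<Sum>l\<in>insert a L - {k}. g k l)
      = 2 * (\<Sum>l\<in>L. g a l) + (\<Sum>k\<in>L. \<Sum>l\<in>L - {k}. g k l)"
    using insert.hyps by simp
  moreover have "even (\<Sum>k\<in>L. \<Sum>l\<in>L - {k}. g k l)"
    using insert by auto
  ultimately show ?case by simp
qed simp

lemma sum_offdiag_swap: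
  assumes "finite L"
  shows "(\<Sum>k\<in>L. \<Sum>l\<in>L - {k}. g k l) = (\<Sum>k\<in>L. \<Sum>l\<in>L - {k}. g l k)"
proof -
  \<comment> \<open>The inner range depends on \<open>k\<close>; extending the summand by 0 to the
    full square makes \<open>sum.swap\<close> applicable.\<close>
  have *: "(\<Sum>k\<in>L. \<Sum>l\<in>L - {k}. h k l) = (\<Sum>k\<in>L. \<Sum>l\<in>L. if k = l then 0 else h k l)" for h :: "'a \<Rightarrow> 'a \<Rightarrow> 'b"
    using assms by (intro sum.cong refl sum.mono_neutral_cong_left) auto
  show ?thesis
    unfolding * by (subst sum.swap) (intro sum.cong refl, auto)
qed

text \<open>The modulo 2 version of the vanishing of a pfaffian with two equal rows.\<close>

lemma even_sum_haf_repeated: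
  fixes w :: "'a set \<Rightarrow> int"
  assumes "finite L" "b \<notin> L"
  shows "even (\<Sum>k\<in>L. w {b, k} * haf w (insert b (L - {k})))"
proof -
  \<comment> \<open>A second expansion along \<open>b\<close> makes the summand symmetric in
    \<open>k\<close> and \<open>l\<close>.\<close>
  have "(\<Sum>k\<in>L. w {b, k} * haf w (insert b (L - {k})))
      = (\<Sum>k\<in>L. \<Sum>l\<in>L - {k}. w {b, k} * (w {b, l} * haf w (L - {k} - {l})))"
    using assms by (simp add: haf_insert sum_distrib_left)
  moreover have "even \<dots>"
    using assms(1) by (rule even_sum_offdiag_symmetric) (simp add: Diff_insert2[symmetric] insert_commute)
  ultimately show ?thesis by simp
qed

text \<open>The weights \<open>w'\<close> are, modulo 2, the entries of the Schur complement of the block on \<open>{p, q}\<close>.\<close>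

lemma haf_pivot:
  fixes w w' :: "'a set \<Rightarrow> int"
  assumes "finite J" "p \<noteq> q" "p \<notin> J" "q \<notin> J" "odd (w {p, q})"
    and "\<And>i k. i \<in> J \<Longrightarrow> k \<in> J \<Longrightarrow> i \<noteq> k \<Longrightarrow>
      [w' {i, k} = w {i, k} + w {p, i} * w {q, k} + w {q, i} * w {p, k}] (mod 2)"
  shows "[haf w (insert p (insert q J)) = haf w' J] (mod 2)"
  using assms
proof (induction "card J" arbitrary: J rule: less_induct)
  case less
  note pq = less.prems(2-5)
  show ?case
  proof (cases "J = {}")
    case True
    then show ?thesis
      using pq by (simp add: haf_insert cong_iff_dvd_diff)
  next
    case False
    then obtain i where i: "i \<in> J" by auto
    define K where "K = J - {i}"
    have J: "J = insert i K" "i \<notin> K" and K: "finite K" "p \<notin> K" "q \<notin> K" and ne: "i \<noteq> p" "i \<noteq> q"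
      using i less.prems by (auto simp: K_def)
    define A where "A = (\<lambda>k. haf w (insert p (insert q (K - {k}))))"
    have IH: "[haf w' (K - {k}) = A k] (mod 2)" if "k \<in> K" for k
      unfolding A_def using less.prems that J K
      by (intro cong_sym[OF less.hyps]) (auto intro!: psubset_card_mono)
    \<comment> \<open>\<open>even_sum_haf_repeated\<close> on \<open>insert a K\<close> gives an
      even sum. Its term \<open>k = a\<close> has the odd coefficient \<open>w {b, a}\<close>, so
      the remaining terms add up to \<open>haf w (insert b K)\<close> modulo 2.\<close>
    have flip: "[(\<Sum>k\<in>K. w {b, k} * A k) = haf w (insert b K)] (mod 2)"
      if "{a, b} = {p, q}" for a b
    proof -
      have ab: "a \<noteq> b" "a \<notin> K" "b \<notin> K" "odd (w {b, a})"
        using that pq K by (auto simp: doubleton_eq_iff insert_commute)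
      have "even (\<Sum>k\<in>insert a K. w {b, k} * haf w (insert b (insert a K - {k})))"
        using K ab by (intro even_sum_haf_repeated) auto
      also have "(\<Sum>k\<in>insert a K. w {b, k} * haf w (insert b (insert a K - {k})))
          = w {b, a} * haf w (insert b K) + (\<Sum>k\<in>K. w {b, k} * haf w (insert b (insert a K - {k})))"
        using K ab by simp
      also have "(\<Sum>k\<in>K. w {b, k} * haf w (insert b (insert a K - {k}))) = (\<Sum>k\<in>K. w {b, k} * A k)"
      proof (intro sum.cong refl)
        fix k assume "k \<in> K"
        then have "insert b (insert a K - {k}) = insert p (insert q (K - {k}))"
          using ab that by (auto simp: doubleton_eq_iff)
        then show "w {b, k} * haf w (insert b (insert a K - {k})) = w {b, k} * A k"
          by (simp add: A_def)
      qed
      finally show ?thesis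
        using ab(4) by (auto simp: cong_iff_dvd_diff)
    qed
    \<comment> \<open>Expansion along \<open>i\<close>: its partner is \<open>p\<close>,
      \<open>q\<close> or a point of \<open>K\<close>.\<close>
    have "haf w (insert p (insert q J)) = haf w (insert i (insert p (insert q K)))"
      by (simp add: J insert_commute)
    also have "\<dots> = (\<Sum>k\<in>insert p (insert q K). w {i, k} * haf w (insert p (insert q K) - {k}))"
      using K J ne by (intro haf_insert) auto
    also have "\<dots> = w {p, i} * haf w (insert q K) + w {q, i} * haf w (insert p K)
        + (\<Sum>k\<in>K. w {i, k} * haf w (insert p (insert q K) - {k}))"
      using K pq by (simp add: insert_Diff_if insert_commute)
    also have "(\<Sum>k\<in>K. w {i, k} * haf w (insert p (insert q K) - {k})) = (\<Sum>k\<in>K. w {i, k} * A k)"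
      unfolding A_def using K by (intro sum.cong refl arg_cong2[where f = "(*)"] arg_cong[where f = "haf w"]) auto
    finally have L: "haf w (insert p (insert q J)) = w {p, i} * haf w (insert q K)
        + w {q, i} * haf w (insert p K) + (\<Sum>k\<in>K. w {i, k} * A k)" .
    \<comment> \<open>The same expansion for \<open>w'\<close>: by \<open>flip\<close>, the
      correction products in \<open>w' {i, k}\<close> sum to the two terms in which \<open>i\<close>
      is matched with \<open>p\<close> or \<open>q\<close>.\<close>
    have "[haf w' J = (\<Sum>k\<in>K. w' {i, k} * haf w' (K - {k}))] (mod 2)"
      using J K by (simp add: haf_insert)
    also have "[(\<Sum>k\<in>K. w' {i, k} * haf w' (K - {k}))
        = (\<Sum>k\<in>K. (w {i, k} + w {p, i} * w {q, k} + w {q, i} * w {p, k}) * A k)] (mod 2)"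
      using J less.prems(6) by (intro cong_sum cong_mult IH) auto
    also have "(\<Sum>k\<in>K. (w {i, k} + w {p, i} * w {q, k} + w {q, i} * w {p, k}) * A k)
        = w {p, i} * (\<Sum>k\<in>K. w {q, k} * A k) + w {q, i} * (\<Sum>k\<in>K. w {p, k} * A k)
          + (\<Sum>k\<in>K. w {i, k} * A k)"
      by (simp add: sum_distrib_left sum.distrib[symmetric] algebra_simps)
    also have "[\<dots> = haf w (insert p (insert q J))] (mod 2)"
      unfolding L by (intro cong_add cong_mult cong_refl flip) auto
    finally show ?thesis
      by (rule cong_sym)
  qed
qed

section \<open>Partial matchings and the discriminant pfaffian modulo 2\<close>

definition partial_haf :: "('a set \<Rightarrow> 'b::comm_semiring_1) \<Rightarrow> ('a \<Rightarrow> 'b) \<Rightarrow> 'a set \<Rightarrow> 'b" where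
  "partial_haf w v L = (\<Sum>J\<in>Pow L. haf w J * prod v (L - J))"

text \<open>\<open>partial_haf\<close> is the loop hafnian with loop weights \<open>v\<close>:
  points outside \<open>J\<close> are matched with themselves. So \<open>i\<close> either carries a
  loop or is paired with some \<open>k\<close>.\<close>

lemma partial_haf_insert:
  assumes L: "finite L" "i \<notin> L"
  shows "partial_haf w v (insert i L)
    = v i * partial_haf w v L + (\<Sum>k\<in>L. w {i, k} * partial_haf w v (L - {k}))"
proof -
  have "inj_on (insert i) (Pow L)"
    using L by (auto intro!: inj_onI simp: insert_ident)
  then have "partial_haf w v (insert i L) = (\<Sum>J\<in>Pow L. haf w J * prod v (insert i L - J))
      + (\<Sum>J\<in>Pow L. haf w (insert i J) * prod v (insert i L - insert i J))"
    unfolding partial_haf_def Pow_insert using L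
    by (subst sum.union_disjoint) (auto simp: sum.reindex)
  also have "(\<Sum>J\<in>Pow L. haf w J * prod v (insert i L - J)) = v i * partial_haf w v L"
    unfolding partial_haf_def sum_distrib_left
  proof (intro sum.cong refl)
    fix J assume J: "J \<in> Pow L"
    then have "insert i L - J = insert i (L - J)" using L by auto
    then show "haf w J * prod v (insert i L - J) = v i * (haf w J * prod v (L - J))"
      using L by (simp add: ac_simps)
  qed
  \<comment> \<open>Writing the condition \<open>k \<in> J\<close> as an indicator makes the range
    of \<open>k\<close> independent of \<open>J\<close>, so that the two sums can be
    exchanged.\<close>
  also have "(\<Sum>J\<in>Pow L. haf w (insert i J) * prod v (insert i L - insert i J))
     = (\<Sum>J\<in>Pow L. \<Sum>k\<in>L. if k \<in> J then w {i, k} * (haf w (J - {k}) * prod v (L - J)) else 0)"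
  proof (intro sum.cong refl)
    fix J assume J: "J \<in> Pow L"
    then have fin: "finite J" and i: "i \<notin> J" using L finite_subset by auto
    have "insert i L - insert i J = L - J" using L by auto
    moreover have "L \<inter> J = J" using J by auto
    ultimately show "haf w (insert i J) * prod v (insert i L - insert i J)
      = (\<Sum>k\<in>L. if k \<in> J then w {i, k} * (haf w (J - {k}) * prod v (L - J)) else 0)"
      using L by (simp add: haf_insert[OF fin i] sum_distrib_left ac_simps sum.inter_restrict[symmetric])
  qed
  also have "\<dots> = (\<Sum>k\<in>L. \<Sum>J\<in>Pow L. if k \<in> J then w {i, k} * (haf w (J - {k}) * prod v (L - J)) else 0)"
    by (rule sum.swap)
  also have "\<dots> = (\<Sum>k\<in>L. w {i, k} * partial_haf w v (L - {k}))"
  proof (intro sum.cong refl)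
    fix k assume k: "k \<in> L"
    have inj: "inj_on (insert k) (Pow (L - {k}))"
      by (auto intro!: inj_onI simp: insert_ident)
    have img: "insert k ` Pow (L - {k}) = {J \<in> Pow L. k \<in> J}"
    proof (intro equalityI subsetI)
      fix J assume "J \<in> {J \<in> Pow L. k \<in> J}"
      then have "J = insert k (J - {k})" "J - {k} \<in> Pow (L - {k})" by auto
      then show "J \<in> insert k ` Pow (L - {k})" by blast
    qed (use k in auto)
    have "(\<Sum>J\<in>Pow L. if k \<in> J then w {i, k} * (haf w (J - {k}) * prod v (L - J)) else 0)
      = (\<Sum>J\<in>{J \<in> Pow L. k \<in> J}. w {i, k} * (haf w (J - {k}) * prod v (L - J)))"
      using L by (intro sum.inter_filter[symmetric]) auto
    also have "\<dots> = (\<Sum>J\<in>Pow (L - {k}). w {i, k} * (haf w (insert k J - {k}) * prod v (L - insert k J)))"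
      unfolding img[symmetric] by (simp add: sum.reindex[OF inj])
    also have "\<dots> = (\<Sum>J\<in>Pow (L - {k}). w {i, k} * (haf w J * prod v (L - {k} - J)))"
    proof (intro sum.cong refl)
      fix J assume J: "J \<in> Pow (L - {k})"
      then have "insert k J - {k} = J" "L - insert k J = L - {k} - J" by auto
      then show "w {i, k} * (haf w (insert k J - {k}) * prod v (L - insert k J))
        = w {i, k} * (haf w J * prod v (L - {k} - J))" by simp
    qed
    finally show "(\<Sum>J\<in>Pow L. if k \<in> J then w {i, k} * (haf w (J - {k}) * prod v (L - J)) else 0)
      = w {i, k} * partial_haf w v (L - {k})"
      by (simp add: partial_haf_def sum_distrib_left)
  qed
  finally show ?thesis .
qed

text \<open>In the hafnian of w + v v^T, the pairs that take their factor from v v^T cover a set R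
  and contribute the product of \<open>v\<close> over R once per perfect matching of R, an odd
  number of times. For odd size the right side is the hafnian of \<open>w'\<close> bordered by
  \<open>v\<close>. Both parities go through one induction, because deleting \<open>i\<close>
  changes the parity and deleting \<open>{i, k}\<close> keeps it.\<close>

lemma partial_haf_cong_haf:
  fixes w w' :: "'a set \<Rightarrow> int"
  assumes "finite L"
    and "\<And>i k. i \<in> L \<Longrightarrow> k \<in> L \<Longrightarrow> i \<noteq> k \<Longrightarrow> [w' {i, k} = w {i, k} + v i * v k] (mod 2)"
  shows "[partial_haf w v L = (if even (card L) then haf w' L else \<Sum>k\<in>L. v k * haf w' (L - {k}))] (mod 2)"
  using assms
proof (induction "card L" arbitrary: L rule: less_induct)
  case less
  show ?case
  proof (cases "L = {}")
    case True
    then show ?thesis by (simp add: partial_haf_def)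
  next
    case False
    then obtain i where i: "i \<in> L" by auto
    define K where "K = L - {i}"
    have L: "L = insert i K" "i \<notin> K" and K: "finite K"
      using i less.prems by (auto simp: K_def)
    have cardL: "card L = Suc (card K)"
      using L K by simp
    have cardK: "card K = Suc (card (K - {k}))" if "k \<in> K" for k
      by (rule card.remove[OF K that])
    note IH = less.hyps[OF _ _ less.prems(2)]
    have w': "\<And>k. k \<in> K \<Longrightarrow> [w' {i, k} = w {i, k} + v i * v k] (mod 2)"
      by (intro less.prems(2)) (use L in auto)
    have G: "partial_haf w v L = v i * partial_haf w v K + (\<Sum>k\<in>K. w {i, k} * partial_haf w v (K - {k}))"
      using L K by (simp add: partial_haf_insert)
    show ?thesis
    proof (cases "even (card L)")
      case True
      have "[partial_haf w v K = (\<Sum>k\<in>K. v k * haf w' (K - {k}))] (mod 2)"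
        using IH[of K] True cardL K L by auto
      moreover have "[partial_haf w v (K - {k}) = haf w' (K - {k})] (mod 2)" if "k \<in> K" for k
        using IH[of "K - {k}"] True cardL K L cardK[OF that] by auto
      ultimately have "[partial_haf w v L = v i * (\<Sum>k\<in>K. v k * haf w' (K - {k}))
          + (\<Sum>k\<in>K. w {i, k} * haf w' (K - {k}))] (mod 2)"
        unfolding G by (intro cong_add cong_mult cong_refl cong_sum) auto
      \<comment> \<open>The two sums merge because \<open>w {i, k} + v i * v k\<close> is
        \<open>w' {i, k}\<close> modulo 2; what remains is the expansion of \<open>haf w' L\<close>
        along \<open>i\<close>.\<close>
      also have "v i * (\<Sum>k\<in>K. v k * haf w' (K - {k})) + (\<Sum>k\<in>K. w {i, k} * haf w' (K - {k}))
          = (\<Sum>k\<in>K. (w {i, k} + v i * v k) * haf w' (K - {k}))"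
        by (simp add: sum_distrib_left sum.distrib[symmetric] algebra_simps)
      also have "[\<dots> = (\<Sum>k\<in>K. w' {i, k} * haf w' (K - {k}))] (mod 2)"
        by (intro cong_sum cong_mult cong_refl cong_sym[OF w'])
      also have "(\<Sum>k\<in>K. w' {i, k} * haf w' (K - {k})) = haf w' L"
        using L K by (simp add: haf_insert)
      finally show ?thesis
        using True by simp
    next
      case False
      have "[partial_haf w v K = haf w' K] (mod 2)"
        using IH[of K] False cardL K L by auto
      moreover have "[partial_haf w v (K - {k}) = (\<Sum>l\<in>K - {k}. v l * haf w' (K - {k} - {l}))] (mod 2)"
        if "k \<in> K" for k
        using IH[of "K - {k}"] False cardL K L cardK[OF that] by auto
      ultimately have 1: "[partial_haf w v L = v i * haf w' K
          + (\<Sum>k\<in>K. w {i, k} * (\<Sum>l\<in>K - {k}. v l * haf w' (K - {k} - {l})))] (mod 2)"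
        unfolding G by (intro cong_add cong_mult cong_refl cong_sum) auto
      define h where "h = (\<lambda>k l. haf w' (K - {k} - {l}))"
      \<comment> \<open>\<open>S1\<close> carries the old weights. Since \<open>S2\<close> is even,
        \<open>v i * S2\<close> can be added to it modulo 2, which turns \<open>w {i, l}\<close>
        into \<open>w' {i, l}\<close>.\<close>
      define S1 where "S1 = (\<Sum>k\<in>K. \<Sum>l\<in>K - {k}. v k * (w {i, l} * h k l))"
      define S2 where "S2 = (\<Sum>k\<in>K. \<Sum>l\<in>K - {k}. v k * (v l * h k l))"
      have h_sym: "h k l = h l k" for k l
        by (simp add: h_def Diff_insert2[symmetric] insert_commute)
      have "(\<Sum>k\<in>K. w {i, k} * (\<Sum>l\<in>K - {k}. v l * h k l))
          = (\<Sum>k\<in>K. \<Sum>l\<in>K - {k}. w {i, l} * (v k * h l k))"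
        unfolding sum_distrib_left by (rule sum_offdiag_swap[OF K])
      also have "\<dots> = S1"
        unfolding S1_def by (intro sum.cong refl) (simp add: h_sym ac_simps)
      finally have 2: "(\<Sum>k\<in>K. w {i, k} * (\<Sum>l\<in>K - {k}. v l * h k l)) = S1" .
      have 3: "even S2"
        unfolding S2_def using K by (rule even_sum_offdiag_symmetric) (subst h_sym, simp add: ac_simps)
      have "S1 + v i * S2 = (\<Sum>k\<in>K. v k * (\<Sum>l\<in>K - {k}. (w {i, l} + v i * v l) * h k l))"
        unfolding S1_def S2_def sum_distrib_left sum.distrib[symmetric]
        by (intro sum.cong refl) (simp add: algebra_simps)
      moreover have "[(\<Sum>k\<in>K. v k * (\<Sum>l\<in>K - {k}. (w {i, l} + v i * v l) * h k l))
          = (\<Sum>k\<in>K. v k * (\<Sum>l\<in>K - {k}. w' {i, l} * h k l))] (mod 2)"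
        by (intro cong_sum cong_mult cong_refl cong_sym[OF w']) auto
      moreover have "(\<Sum>k\<in>K. v k * (\<Sum>l\<in>K - {k}. w' {i, l} * h k l)) = (\<Sum>k\<in>K. v k * haf w' (L - {k}))"
      proof (intro sum.cong refl)
        fix k assume "k \<in> K"
        then have "L - {k} = insert i (K - {k})" using L by auto
        then show "v k * (\<Sum>l\<in>K - {k}. w' {i, l} * h k l) = v k * haf w' (L - {k})"
          using L K by (simp add: haf_insert h_def)
      qed
      ultimately have 4: "[S1 + v i * S2 = (\<Sum>k\<in>K. v k * haf w' (L - {k}))] (mod 2)"
        by simp
      have 5: "(\<Sum>k\<in>L. v k * haf w' (L - {k})) = v i * haf w' K + (\<Sum>k\<in>K. v k * haf w' (L - {k}))"
        using L K by simp
      have "[partial_haf w v L = v i * haf w' K + S1] (mod 2)"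
        using 1 by (simp add: 2[unfolded h_def])
      moreover have "[v i * haf w' K + S1 = v i * haf w' K + (S1 + v i * S2)] (mod 2)"
        using 3 by (simp add: cong_iff_dvd_diff)
      moreover note cong_add[OF cong_refl[of "v i * haf w' K"] 4, folded 5]
      ultimately show ?thesis
        using False by (auto intro: cong_trans)
    qed
  qed
qed

lemma dpf_eq_partial_haf:
  "dpf B = partial_haf (edge_entry B) (\<lambda>k. B $$ (0, k)) {1..<dim_row B}"
proof -
  have "partial_haf (edge_entry B) (\<lambda>k. B $$ (0, k)) {1..<dim_row B}
    = (\<Sum>J\<in>{J. J \<subseteq> {1..<dim_row B} \<and> even (card J)}.
        haf (edge_entry B) J * (\<Prod>k\<in>{1..<dim_row B} - J. B $$ (0, k)))"
    unfolding partial_haf_def by (rule sum.mono_neutral_right) (auto simp: haf_odd)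
  then show ?thesis
    by (simp add: dpf_def haf_def sum_distrib_right)
qed

section \<open>Determinants modulo 4\<close>

lemma det_cong_mod:
  fixes A B :: "int mat"
  assumes "A \<in> carrier_mat n n" "B \<in> carrier_mat n n"
    and "\<And>i j. i < n \<Longrightarrow> j < n \<Longrightarrow> [A $$ (i, j) = B $$ (i, j)] (mod m)"
  shows "[det A = det B] (mod m)"
  unfolding det_def'[OF assms(1)] det_def'[OF assms(2)]
  by (intro cong_sum cong_mult cong_prod cong_refl assms(3)) (auto simp: permutes_in_image)

text \<open>The sign of \<open>p\<close> enters twice, once through the rows and once, after
  transposing, through the columns.\<close>

lemma det_permute_rows_cols:
  fixes A :: "'a::comm_ring_1 mat"
  assumes A: "A \<in> carrier_mat n n" and p: "p permutes {0..<n}"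
  shows "det (mat n n (\<lambda>(i, j). A $$ (p i, p j))) = det A"
proof -
  define C where "C = mat n n (\<lambda>(i, j). A $$ (p i, j))"
  have C: "C \<in> carrier_mat n n"
    by (simp add: C_def)
  have "mat n n (\<lambda>(i, j). C\<^sup>T $$ (p i, j)) = (mat n n (\<lambda>(i, j). A $$ (p i, p j)))\<^sup>T"
    using p by (intro eq_matI) (auto simp: C_def)
  then have "det (mat n n (\<lambda>(i, j). A $$ (p i, p j))) = det (mat n n (\<lambda>(i, j). C\<^sup>T $$ (p i, j)))"
    by (metis det_transpose mat_carrier)
  also have "\<dots> = signof p * det C"
    using det_permute_rows[of "C\<^sup>T" n p] C p by (simp add: det_transpose)
  also have "\<dots> = signof p * signof p * det A"
    unfolding C_def using det_permute_rows[OF A p] by simp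
  finally show ?thesis
    by (simp add: sign_def split: if_splits)
qed

lemma det_2_2:
  fixes a b c d :: "'a::idom"
  shows "det (mat 2 2 (\<lambda>(i, j). if i = 0 then if j = 0 then a else b else if j = 0 then c else d))
    = a * d - b * c"
  by (subst laplace_expansion_row[of _ 2 0])
     (auto simp: numeral_2_eq_2 cofactor_def mat_delete_def det_single)

text \<open>The adjugate of the leading block replaces its inverse, which is why \<open>\<delta> ^ q\<close> appears on the left.\<close>

lemma det_schur:
  fixes S :: "'a::idom mat"
  defines "\<delta> \<equiv> S $$ (0, 0) * S $$ (1, 1) - S $$ (0, 1) * S $$ (1, 0)"
  assumes S: "S \<in> carrier_mat (q + 2) (q + 2)"
  shows "\<delta> ^ q * det S = \<delta> * det (mat q q (\<lambda>(i, j). \<delta> * S $$ (i + 2, j + 2)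
     + (S $$ (1, 0) * S $$ (i + 2, 1) - S $$ (1, 1) * S $$ (i + 2, 0)) * S $$ (0, j + 2)
     + (S $$ (0, 1) * S $$ (i + 2, 0) - S $$ (0, 0) * S $$ (i + 2, 1)) * S $$ (1, j + 2)))"
    (is "_ = \<delta> * det ?E")
proof -
  \<comment> \<open>By Cramer's rule, \<open>X i\<close> and \<open>Y i\<close> are the multiples of
    rows 0 and 1 that, added to \<open>\<delta>\<close> times row \<open>i\<close>, clear its first
    two entries. Left multiplication by \<open>M\<close> performs this elimination without
    division.\<close>
  define X where "X = (\<lambda>i. S $$ (1, 0) * S $$ (i, 1) - S $$ (1, 1) * S $$ (i, 0))"
  define Y where "Y = (\<lambda>i. S $$ (0, 1) * S $$ (i, 0) - S $$ (0, 0) * S $$ (i, 1))"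
  define M where "M = mat (q + 2) (q + 2) (\<lambda>(i, k).
    if k = i then if i < 2 then 1 else \<delta> else if i < 2 then 0 else if k = 0 then X i else if k = 1 then Y i else 0)"
  define T where "T = mat (q + 2) (q + 2) (\<lambda>(i, j). if i < 2 then S $$ (i, j)
    else if j < 2 then 0 else \<delta> * S $$ (i, j) + X i * S $$ (0, j) + Y i * S $$ (1, j))"
  have MS: "(\<Sum>k<q + 2. M $$ (i, k) * S $$ (k, j)) = T $$ (i, j)" if ij: "i < q + 2" "j < q + 2" for i j
  proof (cases "i < 2")
    case True
    have "(\<Sum>k<q + 2. M $$ (i, k) * S $$ (k, j)) = (\<Sum>k<q + 2. if k = i then S $$ (k, j) else 0)"
      using ij True by (intro sum.cong) (auto simp: M_def)
    then show ?thesis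
      using ij True by (simp add: T_def)
  next
    case False
    have "(\<Sum>k<q + 2. M $$ (i, k) * S $$ (k, j))
      = (\<Sum>k<q + 2. (if k = i then \<delta> * S $$ (k, j) else 0) + (if k = 0 then X i * S $$ (k, j) else 0)
        + (if k = 1 then Y i * S $$ (k, j) else 0))"
      using ij False by (intro sum.cong) (auto simp: M_def)
    also have "\<dots> = \<delta> * S $$ (i, j) + X i * S $$ (0, j) + Y i * S $$ (1, j)"
      using ij by (simp add: sum.distrib del: sum.lessThan_Suc add_2_eq_Suc')
    also have "\<dots> = T $$ (i, j)"
    proof (cases "j < 2")
      case True
      then have "j = 0 \<or> j = 1" by auto
      then show ?thesis
        using ij False by (auto simp: T_def X_def Y_def \<delta>_def algebra_simps)
    qed (use ij False in \<open>simp add: T_def\<close>)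
    finally show ?thesis .
  qed
  have M: "M \<in> carrier_mat (q + 2) (q + 2)"
    by (simp add: M_def)
  have "M * S = T"
  proof (rule eq_matI)
    fix i j assume "i < dim_row T" "j < dim_col T"
    then have ij: "i < q + 2" "j < q + 2" by (auto simp: T_def)
    then have "(M * S) $$ (i, j) = (\<Sum>k<q + 2. M $$ (i, k) * S $$ (k, j))"
      using M S by (simp add: scalar_prod_def atLeast0LessThan)
    then show "(M * S) $$ (i, j) = T $$ (i, j)"
      using MS[OF ij] by simp
  qed (use M S in \<open>auto simp: T_def\<close>)
  then have "det M * det S = det T"
    using det_mult[OF M S] by simp
  moreover have "det M = \<delta> ^ q"
  proof -
    have "det M = (\<Prod>i = 0..<q + 2. M $$ (i, i))"
      using det_lower_triangular[OF _ M] M unfolding prod_list_diag_prod by (auto simp: M_def)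
    also have "\<dots> = (\<Prod>i<q + 2. if i < 2 then 1 else \<delta>)"
      by (intro prod.cong) (auto simp: M_def)
    also have "\<dots> = \<delta> ^ q"
      by (simp add: numeral_2_eq_2 prod.lessThan_Suc_shift del: prod.lessThan_Suc)
    finally show ?thesis .
  qed
  moreover have "det T = \<delta> * det ?E"
  proof -
    have "T = four_block_mat
        (mat 2 2 (\<lambda>(i, j). if i = 0 then if j = 0 then S $$ (0, 0) else S $$ (0, 1)
          else if j = 0 then S $$ (1, 0) else S $$ (1, 1)))
        (mat 2 q (\<lambda>(i, j). S $$ (i, j + 2))) (0\<^sub>m q 2) ?E"
    proof (rule eq_matI, goal_cases)
      case (1 i j)
      have "i < 2 \<Longrightarrow> i = 0 \<or> i = 1" "j < 2 \<Longrightarrow> j = 0 \<or> j = 1" by auto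
      moreover have "\<not> i < 2 \<Longrightarrow> Suc (Suc (i - 2)) = i" "\<not> j < 2 \<Longrightarrow> Suc (Suc (j - 2)) = j" by auto
      ultimately show ?case
        using 1 by (auto simp: T_def X_def Y_def four_block_mat_def Let_def)
    qed (auto simp: T_def)
    then have "det T = det (mat 2 2 (\<lambda>(i, j). if i = 0 then if j = 0 then S $$ (0, 0) else S $$ (0, 1)
          else if j = 0 then S $$ (1, 0) else S $$ (1, 1))) * det ?E"
      by (simp add: det_four_block_mat_lower_left_zero[where n = 2 and m = q])
    then show ?thesis
      by (simp only: det_2_2 \<delta>_def)
  qed
  ultimately show ?thesis
    by simp
qed

section \<open>Symmetric integer matrices with even diagonal\<close>

lemma haf_cong_0:
  fixes w :: "'a set \<Rightarrow> int"
  assumes "finite J" "J \<noteq> {}" "\<And>i k. i \<in> J \<Longrightarrow> k \<in> J \<Longrightarrow> [w {i, k} = 0] (mod m)"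
  shows "[haf w J = 0] (mod m)"
proof -
  \<comment> \<open>The expansion needs a point; the hafnian of the empty set is 1.\<close>
  obtain i where i: "i \<in> J" using assms by auto
  have "[(\<Sum>k\<in>J - {i}. w {i, k} * haf w (J - {i, k})) = (\<Sum>k\<in>J - {i}. 0 * haf w (J - {i, k}))] (mod m)"
    using i by (intro cong_sum cong_mult cong_refl assms(3)) auto
  then show ?thesis
    by (simp add: haf_expand[OF assms(1) i])
qed

text \<open>An even change \<open>2 * c\<close> alters the square by
  \<open>4 * (b * c + c\<^sup>2)\<close>. This is how hafnians known only modulo 2 suffice modulo
  4.\<close>

lemma cong_square_mod_4:
  fixes a b :: int
  assumes "[a = b] (mod 2)"
  shows "[a\<^sup>2 = b\<^sup>2] (mod 4)"
proof -
  obtain c where "a - b = 2 * c"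
    using assms unfolding cong_iff_dvd_diff by (elim dvdE)
  then have "a = b + 2 * c" by simp
  then have "a\<^sup>2 - b\<^sup>2 = 4 * (b * c + c\<^sup>2)"
    by (simp add: power2_eq_square algebra_simps)
  then show ?thesis
    by (simp add: cong_iff_dvd_diff)
qed

text \<open>The induction step of \<open>det_symmetric_even_diag_cong_haf\<close> with the odd entry
  already in position (0, 1); \<open>IH\<close> is that result for size \<open>2 * m\<close>.
  Elimination passes to \<open>E\<close>, which is \<open>\<delta>\<close> times the Schur
  complement of the leading block.\<close>

lemma det_cong_haf_pivot:
  fixes S :: "int mat" and w :: "nat set \<Rightarrow> int"
  assumes S: "S \<in> carrier_mat (2 * m + 2) (2 * m + 2)"
    and sym: "\<And>i j. i < 2 * m + 2 \<Longrightarrow> j < 2 * m + 2 \<Longrightarrow> S $$ (i, j) = S $$ (j, i)"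
    and diag: "\<And>i. i < 2 * m + 2 \<Longrightarrow> even (S $$ (i, i))"
    and w: "\<And>i j. i < 2 * m + 2 \<Longrightarrow> j < 2 * m + 2 \<Longrightarrow> i \<noteq> j \<Longrightarrow> [w {i, j} = S $$ (i, j)] (mod 2)"
    and pivot: "odd (S $$ (0, 1))"
    and IH: "\<And>(S' :: int mat) w'. S' \<in> carrier_mat (2 * m) (2 * m) \<Longrightarrow>
      (\<And>i j. i < 2 * m \<Longrightarrow> j < 2 * m \<Longrightarrow> S' $$ (i, j) = S' $$ (j, i)) \<Longrightarrow>
      (\<And>i. i < 2 * m \<Longrightarrow> even (S' $$ (i, i))) \<Longrightarrow>
      (\<And>i j. i < 2 * m \<Longrightarrow> j < 2 * m \<Longrightarrow> i \<noteq> j \<Longrightarrow> [w' {i, j} = S' $$ (i, j)] (mod 2)) \<Longrightarrow>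
      [det S' = (-1) ^ m * (haf w' {..<2 * m})\<^sup>2] (mod 4)"
  shows "[det S = (-1) ^ Suc m * (haf w {..<2 * m + 2})\<^sup>2] (mod 4)"
proof -
  define \<delta> where "\<delta> = S $$ (0, 0) * S $$ (1, 1) - S $$ (0, 1) * S $$ (1, 0)"
  define E where "E = mat (2 * m) (2 * m) (\<lambda>(i, j). \<delta> * S $$ (i + 2, j + 2)
     + (S $$ (1, 0) * S $$ (i + 2, 1) - S $$ (1, 1) * S $$ (i + 2, 0)) * S $$ (0, j + 2)
     + (S $$ (0, 1) * S $$ (i + 2, 0) - S $$ (0, 0) * S $$ (i + 2, 1)) * S $$ (1, j + 2))"
  define w' where "w' = edge_entry E"
  have S10: "S $$ (1, 0) = S $$ (0, 1)"
    by (intro sym) auto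
  obtain a where a: "S $$ (0, 0) = 2 * a" using diag[of 0] by auto
  obtain d where d: "S $$ (1, 1) = 2 * d" using diag[of 1] by auto
  obtain u where u: "S $$ (0, 1) = 2 * u + 1" using pivot by (elim oddE)
  \<comment> \<open>The even diagonal contributes a multiple of 4, and the square of an odd number
    is 1 modulo 4.\<close>
  have \<delta>: "[\<delta> = -1] (mod 4)"
  proof -
    have "\<delta> - (-1) = 4 * (a * d - u * u - u)"
      unfolding \<delta>_def S10 a d u by (simp add: algebra_simps)
    then show ?thesis by (simp add: cong_iff_dvd_diff)
  qed
  then have \<delta>2: "odd \<delta>"
    unfolding \<delta>_def S10 a d u by simp
  have E: "E \<in> carrier_mat (2 * m) (2 * m)"
    by (simp add: E_def)
  have E_sym: "E $$ (i, j) = E $$ (j, i)" if "i < 2 * m" "j < 2 * m" for i j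
    using that sym[of "i + 2" "j + 2"] sym[of "i + 2" 0] sym[of "j + 2" 0] sym[of "i + 2" 1] sym[of "j + 2" 1]
    by (simp add: E_def S10[simplified] algebra_simps)
  \<comment> \<open>Modulo 2, \<open>\<delta>\<close> and the pivot are 1 and the diagonal entries
    of the block are 0. What remains is the weight change in \<open>haf_pivot\<close>.\<close>
  have E_mod_2: "even (E $$ (i, j) - (S $$ (i + 2, j + 2)
      + S $$ (i + 2, 1) * S $$ (0, j + 2) + S $$ (i + 2, 0) * S $$ (1, j + 2)))"
    if "i < 2 * m" "j < 2 * m" for i j
  proof -
    obtain e where e: "\<delta> = 2 * e + 1" using \<delta>2 by (elim oddE)
    have *: "E $$ (i, j) = \<delta> * S $$ (i + 2, j + 2)
     + ((2 * u + 1) * S $$ (i + 2, 1) - 2 * d * S $$ (i + 2, 0)) * S $$ (0, j + 2)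
     + ((2 * u + 1) * S $$ (i + 2, 0) - 2 * a * S $$ (i + 2, 1)) * S $$ (1, j + 2)"
      unfolding a[symmetric] d[symmetric] u[symmetric] using that by (simp add: E_def S10[simplified])
    then show ?thesis
      unfolding * e by auto
  qed
  \<comment> \<open>On the diagonal the two products are equal by symmetry and cancel modulo
    2.\<close>
  have E_diag: "even (E $$ (i, i))" if "i < 2 * m" for i
    using E_mod_2[OF that that] diag[of "i + 2"] that sym[of "i + 2" 0] sym[of "i + 2" 1] by auto
  have E_transpose: "E\<^sup>T = E"
    using E E_sym by (intro eq_matI) auto
  have "[det E = (-1) ^ m * (haf w' {..<2 * m})\<^sup>2] (mod 4)"
  proof (rule IH[OF E E_sym E_diag])
    fix i j :: nat assume "i < 2 * m" "j < 2 * m" "i \<noteq> j"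
    then show "[w' {i, j} = E $$ (i, j)] (mod 2)"
      using edge_entry_doubleton[OF E_transpose, of i j] E by (simp add: w'_def)
  qed auto
  moreover have "[haf w' {..<2 * m} = haf w {..<2 * m + 2}] (mod 2)"
  proof -
    define f :: "nat \<Rightarrow> nat" where "f = (\<lambda>i. i + 2)"
    \<comment> \<open>\<open>haf_pivot\<close> compares weights on one index set, so
      \<open>w'\<close> is moved to the indices from 2 on, where truncated subtraction is
      exact.\<close>
    define w'' where "w'' = (\<lambda>e. w' ((\<lambda>i. i - 2) ` e))"
    have "{..<2 * m + 2} = insert 0 (insert 1 (f ` {..<2 * m}))"
    proof (intro equalityI subsetI)
      fix i assume i: "i \<in> {..<2 * m + 2}"
      have "i = 0 \<or> i = 1 \<or> i = f (i - 2) \<and> i - 2 < 2 * m"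
        using i by (auto simp: f_def)
      then show "i \<in> insert 0 (insert 1 (f ` {..<2 * m}))" by blast
    qed (auto simp: f_def)
    moreover have "[haf w (insert 0 (insert 1 (f ` {..<2 * m}))) = haf w'' (f ` {..<2 * m})] (mod 2)"
    proof (rule haf_pivot)
      have "[w {0, 1} = S $$ (0, 1)] (mod 2)"
        by (intro w) auto
      then show "odd (w {0, 1})"
        using pivot by (auto simp: cong_iff_dvd_diff)
      fix i' k' assume "i' \<in> f ` {..<2 * m}" "k' \<in> f ` {..<2 * m}" "i' \<noteq> k'"
      then obtain i k where ik: "i' = i + 2" "k' = k + 2" "i < 2 * m" "k < 2 * m" "i \<noteq> k"
        by (auto simp: f_def)
      have "w'' {i', k'} = E $$ (i, k)"
        using edge_entry_doubleton[OF E_transpose, of i k] E ik by (simp add: w''_def w'_def)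
      also have "[E $$ (i, k) = S $$ (i + 2, k + 2)
          + S $$ (0, i + 2) * S $$ (1, k + 2) + S $$ (1, i + 2) * S $$ (0, k + 2)] (mod 2)"
        using E_mod_2[of i k] ik sym[of "i + 2" 0] sym[of "i + 2" 1] by (auto simp: cong_iff_dvd_diff)
      also have "[S $$ (i + 2, k + 2) + S $$ (0, i + 2) * S $$ (1, k + 2) + S $$ (1, i + 2) * S $$ (0, k + 2)
          = w {i', k'} + w {0, i'} * w {1, k'} + w {1, i'} * w {0, k'}] (mod 2)"
        unfolding ik(1,2) using ik by (intro cong_add cong_mult cong_sym[OF w]) auto
      finally show "[w'' {i', k'} = w {i', k'} + w {0, i'} * w {1, k'} + w {1, i'} * w {0, k'}] (mod 2)" .
    qed (auto simp: f_def)
    moreover have "haf w'' (f ` {..<2 * m}) = haf w' {..<2 * m}"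
      by (subst haf_image) (auto simp: f_def w''_def image_image intro: inj_onI)
    ultimately show ?thesis
      by (simp add: cong_sym_eq)
  qed
  then have "[(haf w' {..<2 * m})\<^sup>2 = (haf w {..<2 * m + 2})\<^sup>2] (mod 4)"
    by (rule cong_square_mod_4)
  ultimately have E_det: "[det E = (-1) ^ m * (haf w {..<2 * m + 2})\<^sup>2] (mod 4)"
    by (meson cong_trans cong_mult cong_refl)
  \<comment> \<open>The exponent is even, so the power of \<open>\<delta>\<close> left by
    \<open>det_schur\<close> is 1 modulo 4. The single factor \<open>\<delta>\<close> on the other
    side supplies the new sign.\<close>
  have "[\<delta> ^ (2 * m) = (-1) ^ (2 * m)] (mod 4)"
    using \<delta> by (rule cong_pow)
  then have "[1 * det S = \<delta> ^ (2 * m) * det S] (mod 4)"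
    by (intro cong_mult cong_refl) (simp add: cong_sym_eq)
  also have "\<delta> ^ (2 * m) * det S = \<delta> * det E"
    using det_schur[OF S] unfolding E_def \<delta>_def .
  also have "[\<delta> * det E = (-1) * ((-1) ^ m * (haf w {..<2 * m + 2})\<^sup>2)] (mod 4)"
    by (intro cong_mult \<delta> E_det)
  finally show ?thesis
    by simp
qed

text \<open>The analogue of det = pf^2: a symmetric matrix with even diagonal is alternating modulo
  2. Each pivot block contributes one factor -1.\<close>

lemma det_symmetric_even_diag_cong_haf:
  fixes S :: "int mat" and w :: "nat set \<Rightarrow> int"
  assumes "S \<in> carrier_mat (2 * m) (2 * m)"
    and "\<And>i j. i < 2 * m \<Longrightarrow> j < 2 * m \<Longrightarrow> S $$ (i, j) = S $$ (j, i)"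
    and "\<And>i. i < 2 * m \<Longrightarrow> even (S $$ (i, i))"
    and "\<And>i j. i < 2 * m \<Longrightarrow> j < 2 * m \<Longrightarrow> i \<noteq> j \<Longrightarrow> [w {i, j} = S $$ (i, j)] (mod 2)"
  shows "[det S = (-1) ^ m * (haf w {..<2 * m})\<^sup>2] (mod 4)"
  using assms
proof (induction m arbitrary: S w)
  case 0
  then show ?case by simp
next
  case (Suc m)
  define n where "n = 2 * m + 2"
  have n: "2 * Suc m = n" by (simp add: n_def)
  note S = Suc.prems[unfolded n]
  show ?case
  proof (cases "\<exists>i<n. \<exists>j<n. odd (S $$ (i, j))")
    case False
    \<comment> \<open>With all entries even, both sides are 0 modulo 4: the determinant is divisible
      by \<open>2 ^ n\<close> with \<open>n \<ge> 2\<close>, and the hafnian is even.\<close>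
    define H where "H = map_mat (\<lambda>x. x div 2) S"
    have "S = 2 \<cdot>\<^sub>m H"
      using S(1) False by (intro eq_matI) (auto simp: H_def)
    moreover have "dim_col H = n"
      using S(1) by (simp add: H_def)
    ultimately have "det S = 2 ^ n * det H"
      by simp
    then have "[det S = 0] (mod 4)"
      by (simp add: n_def cong_iff_dvd_diff)
    moreover have "[haf w {..<n} = 0] (mod 2)"
    proof -
      have "[haf w {..<n} = haf (\<lambda>_. 0) {..<n}] (mod 2)"
        using S(4) False by (intro haf_cong) (auto simp: cong_iff_dvd_diff)
      moreover have "[haf (\<lambda>_. 0) {..<n} = (0::int)] (mod 2)"
        by (rule haf_cong_0) (auto simp: n_def)
      ultimately show ?thesis
        by (rule cong_trans)
    qed
    then have "[(haf w {..<n})\<^sup>2 = 0\<^sup>2] (mod 4)"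
      by (rule cong_square_mod_4)
    ultimately show ?thesis
      unfolding n by (auto simp: cong_iff_dvd_diff)
  next
    case True
    then obtain i j where ij: "i < n" "j < n" "odd (S $$ (i, j))" by blast
    have ne: "i \<noteq> j"
      using ij S(3) by auto
    \<comment> \<open>The inner swap is aimed at \<open>transpose 0 i j\<close>, which the outer
      swap sends to \<open>j\<close>. It fixes 0 because \<open>i \<noteq> j\<close>, so 0 goes to
      \<open>i\<close>.\<close>
    define p where "p = transpose 0 i \<circ> transpose 1 (transpose 0 i j)"
    have p: "p permutes {0..<n}"
      unfolding p_def using ij by (intro permutes_compose permutes_swap_id) (auto simp: n_def transpose_def)
    have p01: "p 0 = i" "p 1 = j"
      using ne by (auto simp: p_def transpose_def)
    have less: "p k < n" if "k < n" for k
      using permutes_in_image[OF p, of k] that by auto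
    have inj: "inj p"
      using p by (rule permutes_inj)
    define T where "T = mat n n (\<lambda>(i, j). S $$ (p i, p j))"
    have "[det T = (-1) ^ Suc m * (haf (\<lambda>e. w (p ` e)) {..<2 * m + 2})\<^sup>2] (mod 4)"
    proof (rule det_cong_haf_pivot[OF _ _ _ _ _ Suc.IH], unfold n_def[symmetric])
      show "odd (T $$ (0, 1))"
        using ij p01 by (simp add: T_def n_def)
    qed (use S less inj in \<open>auto simp: T_def inj_eq\<close>)
    moreover have "det T = det S"
      unfolding T_def using S(1) p by (rule det_permute_rows_cols)
    moreover have "haf (\<lambda>e. w (p ` e)) {..<n} = haf w {..<n}"
      using haf_image[of "{..<n}" p w] permutes_image[OF p] inj
      by (simp add: inj_on_subset atLeast0LessThan)
    ultimately show ?thesis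
      by (simp add: n_def)
  qed
qed

section \<open>Reduction of tracelike matrices by row operations\<close>

lemma det_add_multiples_of_row_0:
  fixes A :: "'a::comm_ring_1 mat"
  assumes A: "A \<in> carrier_mat n n" and n: "0 < n"
  shows "det (mat n n (\<lambda>(i, j). if i = 0 then d * A $$ (0, j) else A $$ (i, j) + c i * A $$ (0, j))) = d * det A"
    (is "det ?T = _")
proof -
  \<comment> \<open>The row operations are left multiplication by a lower triangular matrix with
    diagonal d, 1, ..., 1.\<close>
  define M where "M = mat n n (\<lambda>(i, k). if k = i then if i = 0 then d else 1 else if k = 0 then c i else 0)"
  have M: "M \<in> carrier_mat n n"
    by (simp add: M_def)
  have "M * A = ?T"
  proof (rule eq_matI)
    fix i j assume "i < dim_row ?T" "j < dim_col ?T"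
    then have ij: "i < n" "j < n" by auto
    then have "(M * A) $$ (i, j) = (\<Sum>k<n. M $$ (i, k) * A $$ (k, j))"
      using M A by (simp add: scalar_prod_def atLeast0LessThan)
    also have "\<dots> = (\<Sum>k<n. (if k = i then (if i = 0 then d else 1) * A $$ (k, j) else 0)
        + (if k = 0 then (if i = 0 then 0 else c i) * A $$ (k, j) else 0))"
      using ij by (intro sum.cong) (auto simp: M_def)
    also have "\<dots> = ?T $$ (i, j)"
      using ij n by (simp add: sum.distrib)
    finally show "(M * A) $$ (i, j) = ?T $$ (i, j)" .
  qed (use M A in auto)
  then have "det ?T = det M * det A"
    using det_mult[OF M A] by simp
  also have "det M = (\<Prod>i = 0..<n. M $$ (i, i))"
    using det_lower_triangular[OF _ M] M unfolding prod_list_diag_prod by (auto simp: M_def)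
  also have "\<dots> = (\<Prod>i = 0..<n. if i = 0 then d else 1)"
    by (intro prod.cong) (auto simp: M_def)
  also have "\<dots> = d"
    using n by simp
  finally show ?thesis .
qed

text \<open>It turns \<open>n + 1\<close> (for even \<open>n\<close>) and \<open>n\<close> (for odd
  \<open>n\<close>) into the sign \<open>\<epsilon>\<close> of the main proof.\<close>

lemma double_plus_1_cong_4: "[int (2 * m) + 1 = (-1) ^ m] (mod 4)"
  by (cases "even m") (auto elim!: evenE oddE simp: cong_iff_dvd_diff)

theorem theorem4p2:
  fixes B :: "int mat" and n :: nat
  assumes "B \<in> carrier_mat n n"
    and "tracelike B"
  shows "[det B = (dpf B)\<^sup>2] (mod 4)"
proof -
  note B = assms(1)
  have n: "0 < n" and B_transpose: "B\<^sup>T = B" and B00: "B $$ (0, 0) = int n"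
    and B_diag: "\<And>i. 0 < i \<Longrightarrow> i < n \<Longrightarrow> [B $$ (i, i) = (B $$ (0, i))\<^sup>2] (mod 2)"
    using assms by (auto simp: tracelike_def)
  have B_sym: "B $$ (i, j) = B $$ (j, i)" if "i < n" "j < n" for i j
    using that B B_transpose by (metis carrier_matD index_transpose_mat(1))
  define v where "v = (\<lambda>k. B $$ (0, k))"
  define m where "m = n div 2"
  define \<epsilon> :: int where "\<epsilon> = (-1) ^ m"
  have \<epsilon>2: "\<epsilon> * \<epsilon> = 1" and \<epsilon>_odd: "odd \<epsilon>"
    by (auto simp: \<epsilon>_def power_add[symmetric])
  have diag_even: "even (B $$ (i, i) + v i * v i)" "even (B $$ (i, i) - \<epsilon> * v i * v i)"
    if "0 < i" "i < n" for i
    using B_diag[OF that] \<epsilon>_odd by (auto simp: cong_iff_dvd_diff v_def power2_eq_square)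
  \<comment> \<open>One weight serves both parities: on \<open>{1..<n}\<close> it is B + v v^T, on
    \<open>{..<n}\<close> that matrix bordered by \<open>v\<close>. The corner 0 is a placeholder,
    since hafnians ignore the diagonal.\<close>
  define C where "C = mat n n (\<lambda>(i, j). if i = 0 then if j = 0 then 0 else v j
    else if j = 0 then v i else B $$ (i, j) + v i * v j)"
  define w where "w = edge_entry C"
  have C: "C \<in> carrier_mat n n"
    by (simp add: C_def)
  have "C\<^sup>T = C"
    by (intro eq_matI) (auto simp: C_def B_sym)
  then have w: "w {i, j} = C $$ (i, j)" if "i < n" "j < n" for i j
    unfolding w_def using C that by (intro edge_entry_doubleton) auto
  have dpf_haf: "[dpf B = (if even (card {1..<n}) then haf w {1..<n}
      else \<Sum>k\<in>{1..<n}. v k * haf w ({1..<n} - {k}))] (mod 2)"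
    unfolding dpf_eq_partial_haf carrier_matD(1)[OF B] v_def[symmetric]
  proof (rule partial_haf_cong_haf)
    fix i k assume "i \<in> {1..<n}" "k \<in> {1..<n}" "i \<noteq> k"
    then show "[w {i, k} = edge_entry B {i, k} + v i * v k] (mod 2)"
      using B by (simp add: w edge_entry_doubleton[OF B_transpose] C_def)
  qed simp
  show ?thesis
  proof (cases "even n")
    case True
    then have nm: "n = 2 * m" by (simp add: m_def)
    \<comment> \<open>Adding \<open>v i\<close> times row 0 to row \<open>i\<close> puts
      \<open>(n + 1) * v i\<close> in column 0, which is \<open>\<epsilon> * v i\<close> modulo 4.
      Scaling row 0 by \<open>\<epsilon>\<close> then restores symmetry. The corner is
      \<open>\<epsilon> * n\<close>, even because \<open>n\<close> is.\<close>
    define S where "S = mat n n (\<lambda>(i, j). if i = 0 then \<epsilon> * v j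
      else if j = 0 then \<epsilon> * v i else B $$ (i, j) + v i * v j)"
    have S: "S \<in> carrier_mat (2 * m) (2 * m)"
      by (simp add: S_def nm)
    \<comment> \<open>The left side is the expansion of the bordered hafnian along the border index
      0.\<close>
    have "(\<Sum>k\<in>{1..<n}. v k * haf w ({1..<n} - {k})) = haf w (insert 0 {1..<n})"
      using n by (subst haf_insert) (auto simp: w C_def)
    also have "insert 0 {1..<n} = {..<2 * m}"
      using n by (auto simp: nm)
    finally have dpf: "[dpf B = haf w {..<2 * m}] (mod 2)"
      using dpf_haf True n by simp
    have det_S: "[det S = (-1) ^ m * (haf w {..<2 * m})\<^sup>2] (mod 4)"
    proof (rule det_symmetric_even_diag_cong_haf[OF S])
      fix i j assume ij: "i < 2 * m" "j < 2 * m"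
      show "S $$ (i, j) = S $$ (j, i)"
        using ij by (auto simp: S_def nm B_sym)
      show "[w {i, j} = S $$ (i, j)] (mod 2)" if "i \<noteq> j"
        using ij that \<epsilon>_odd by (auto simp: w C_def S_def nm cong_iff_dvd_diff)
    next
      fix i assume "i < 2 * m"
      then show "even (S $$ (i, i))"
        using diag_even(1)[of i] True B00 by (auto simp: S_def nm v_def)
    qed
    have n1: "[int n + 1 = \<epsilon>] (mod 4)"
      unfolding nm \<epsilon>_def by (rule double_plus_1_cong_4)
    have "[\<epsilon> * det B = det S] (mod 4)"
      unfolding det_add_multiples_of_row_0[OF B n, of \<epsilon> v, symmetric]
    proof (rule det_cong_mod)
      fix i j assume ij: "i < n" "j < n"
      show "[mat n n (\<lambda>(i, j). if i = 0 then \<epsilon> * B $$ (0, j) else B $$ (i, j) + v i * B $$ (0, j)) $$ (i, j)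
        = S $$ (i, j)] (mod 4)"
      proof (cases "i \<noteq> 0 \<and> j = 0")
        case True
        then show ?thesis
          using ij cong_mult[OF n1 cong_refl[of "v i"]]
          by (simp add: S_def B00 B_sym[of i 0] v_def algebra_simps)
      qed (use ij in \<open>auto simp: S_def v_def\<close>)
    qed (auto simp: S_def)
    then have "[\<epsilon> * det B = \<epsilon> * (haf w {..<2 * m})\<^sup>2] (mod 4)"
      using det_S unfolding \<epsilon>_def by (rule cong_trans)
    \<comment> \<open>Multiplying once more by \<epsilon> cancels it, because its square is
      1.\<close>
    from cong_mult[OF cong_refl[of \<epsilon>] this]
    have "[\<epsilon> * \<epsilon> * det B = \<epsilon> * \<epsilon> * (haf w {..<2 * m})\<^sup>2] (mod 4)"
      by (simp only: mult.assoc)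
    then have "[det B = (haf w {..<2 * m})\<^sup>2] (mod 4)"
      by (simp only: \<epsilon>2 mult_1_left)
    then show ?thesis
      using cong_sym[OF cong_square_mod_4[OF dpf]] by (rule cong_trans)
  next
    case False
    then have nm: "n = 2 * m + 1" by (simp add: m_def)
    \<comment> \<open>Subtracting \<open>\<epsilon> * v i\<close> times row 0 from row
      \<open>i\<close> leaves \<open>(1 - \<epsilon> * n) * v i\<close> in column 0, which is 0
      modulo 4 since \<open>n\<close> is \<open>\<epsilon>\<close> there. So \<open>T\<close> is
      block triangular with lower block \<open>D\<close>; as \<open>\<epsilon>\<close> is odd,
      \<open>D\<close> agrees modulo 2 with the shifted weights off the diagonal.\<close>
    define D where "D = mat (2 * m) (2 * m) (\<lambda>(i, j). B $$ (Suc i, Suc j) - \<epsilon> * v (Suc i) * v (Suc j))"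
    define T where "T = four_block_mat (mat 1 1 (\<lambda>_. int n)) (mat 1 (2 * m) (\<lambda>(i, j). v (Suc j))) (0\<^sub>m (2 * m) 1) D"
    have D: "D \<in> carrier_mat (2 * m) (2 * m)"
      by (simp add: D_def)
    have T: "T \<in> carrier_mat n n"
      by (intro carrier_matI) (simp_all add: T_def D_def nm)
    have img: "{1..<n} = Suc ` {..<2 * m}"
      by (simp add: nm lessThan_atLeast0 image_Suc_atLeastLessThan)
    have dpf: "[dpf B = haf (\<lambda>e. w (Suc ` e)) {..<2 * m}] (mod 2)"
      using dpf_haf unfolding img by (simp add: haf_image card_image)
    have det_D: "[det D = (-1) ^ m * (haf (\<lambda>e. w (Suc ` e)) {..<2 * m})\<^sup>2] (mod 4)"
    proof (rule det_symmetric_even_diag_cong_haf[OF D])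
      fix i j assume ij: "i < 2 * m" "j < 2 * m"
      show "D $$ (i, j) = D $$ (j, i)"
        using ij by (auto simp: D_def nm B_sym)
      show "[w (Suc ` {i, j}) = D $$ (i, j)] (mod 2)" if "i \<noteq> j"
        using ij that \<epsilon>_odd by (auto simp: w C_def D_def nm cong_iff_dvd_diff)
    next
      fix i assume "i < 2 * m"
      then show "even (D $$ (i, i))"
        using diag_even(2)[of "Suc i"] by (simp add: D_def nm)
    qed
    have n1: "[int n = \<epsilon>] (mod 4)"
      using double_plus_1_cong_4[of m] unfolding nm \<epsilon>_def by (simp add: add.commute)
    have "[1 * det B = det T] (mod 4)"
      unfolding det_add_multiples_of_row_0[OF B n, of 1 "\<lambda>i. - \<epsilon> * v i", symmetric]
    proof (rule det_cong_mod)
      fix i j assume ij: "i < n" "j < n"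
      show "[mat n n (\<lambda>(i, j). if i = 0 then 1 * B $$ (0, j) else B $$ (i, j) + - \<epsilon> * v i * B $$ (0, j)) $$ (i, j)
        = T $$ (i, j)] (mod 4)"
      proof (cases "i \<noteq> 0 \<and> j = 0")
        case True
        have "[\<epsilon> * int n * v i = \<epsilon> * \<epsilon> * v i] (mod 4)"
          by (intro cong_mult cong_refl n1)
        then have "[v i - \<epsilon> * int n * v i = 0] (mod 4)"
          unfolding \<epsilon>2 by (simp add: cong_iff_dvd_diff dvd_diff_commute)
        then show ?thesis
          using True ij B_sym[of i 0] by (cases i) (simp_all add: T_def D_def nm B00 v_def algebra_simps)
      next
        case False
        then show ?thesis
          using ij by (cases i; cases j) (auto simp: T_def D_def nm v_def B00)
      qed
    qed (use T in auto)
    also have "det T = int n * det D"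
      unfolding T_def by (subst det_four_block_mat_lower_left_zero_col) (auto simp: D_def det_single)
    \<comment> \<open>One sign comes from the corner \<open>n\<close>, the other from
      \<open>det D\<close>; their product is 1.\<close>
    also have "[int n * det D = \<epsilon> * (\<epsilon> * (haf (\<lambda>e. w (Suc ` e)) {..<2 * m})\<^sup>2)] (mod 4)"
      using det_D unfolding \<epsilon>_def[symmetric] by (intro cong_mult n1)
    finally have "[det B = (haf (\<lambda>e. w (Suc ` e)) {..<2 * m})\<^sup>2] (mod 4)"
      by (simp only: mult.assoc[symmetric] \<epsilon>2 mult_1_left)
    then show ?thesis
      using cong_sym[OF cong_square_mod_4[OF dpf]] by (rule cong_trans)
  qed
qed

end
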